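(* Let $a\in\mathbb{R}$, $q,r\in\mathbb{R}$ with $q\neq0$, and $\mathfrak{S}=\{x\in\mathbb{C}: -1\le \operatorname{Im}(x)\le 0\}$. Let $G$ be a complex function that is either odd or even, analytic on an open set (symmetric about $0$) containing $\{a\,x: |\operatorname{Im}(x)|\le1\}$, such that, uniformly for $x\in\mathfrak{S}$ as $\operatorname{Re}(x)\to\pm\infty$, $G(ax)G(a(x+i))=o\!\left(e^{\pi|x|}/|x|\right)$ and $\dfrac{G(ax)\,G(a(x+i))}{\sinh(\pi(q+ir)(2x+i))}\to0$. Assume that the integrand below has no pole on the real axis (automatic if $(q^2+r^2)/q$ is not an integer). Then $$\int_{-\infty}^{\infty}\frac{G(ax)\,G(a(x+i))}{\sinh(\pi(q+ir)(i+2x))}\,dx=-\frac{i}{2}\,\frac{G\!\left(-\frac{ia}{2}\right)G\!\left(\frac{ia}{2}\right)}{q+ir}+\frac{i}{q+ir}\sum_{n=1}^{M}(-1)^{n+1}\,G\!\left(-\frac{i(q+ir-n)a}{2(q+ir)}\right)G\!\left(\frac{i(q+ir+n)a}{2(q+ir)}\right),$$ where $M=\left\lfloor\dfrac{q^2+r^2}{|q|}\right\rfloor$.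
   Context: The integral over the real line is understood as $\lim_{R\to\infty}\int_{-R}^{R}$ (removable singularities of the integrand being filled in). $\lfloor y\rfloor$ is the greatest integer not exceeding $y$; an empty sum is $0$. *)

theory Defs
  imports "HOL-Complex_Analysis.Complex_Analysis" "HOL-Library.Landau_Symbols"
begin

definition strip :: "complex set" where
  "strip = {x. -1 \<le> Im x \<and> Im x \<le> 0}"

(* Limits along this filter are the limits for Re x \<rightarrow> \<plusminus>\<infinity> that are uniform in x \<in> strip:
   "eventually P strip_ends" means that P x holds for all x \<in> strip with \<bar>Re x\<bar> large enough. *)
definition strip_ends :: "complex filter" where
  "strip_ends = inf (filtercomap (\<lambda>x. \<bar>Re x\<bar>) at_top) (principal strip)"

lemma eventually_strip_ends:
  "eventually P strip_ends \<longleftrightarrow> (\<exists>X. \<forall>x\<in>strip. X \<le> \<bar>Re x\<bar> \<longrightarrow> P x)"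
proof
  assume "eventually P strip_ends"
  then obtain Q where Q: "eventually Q (at_top :: real filter)"
      "\<And>x. Q \<bar>Re x\<bar> \<Longrightarrow> x \<in> strip \<Longrightarrow> P x"
    unfolding strip_ends_def eventually_inf_principal eventually_filtercomap by blast
  then show "\<exists>X. \<forall>x\<in>strip. X \<le> \<bar>Re x\<bar> \<longrightarrow> P x"
    unfolding eventually_at_top_linorder by blast
next
  assume "\<exists>X. \<forall>x\<in>strip. X \<le> \<bar>Re x\<bar> \<longrightarrow> P x"
  then obtain X where X: "\<forall>x\<in>strip. X \<le> \<bar>Re x\<bar> \<longrightarrow> P x" by blast
  show "eventually P strip_ends"
    unfolding strip_ends_def eventually_inf_principal eventually_filtercomap
    using X eventually_ge_at_top[of X] by blast
qed

definition integrand :: "(complex \<Rightarrow> complex) \<Rightarrow> real \<Rightarrow> complex \<Rightarrow> complex \<Rightarrow> complex" where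
  "integrand G a w x =
     G (of_real a * x) * G (of_real a * (x + \<i>)) / sinh (of_real pi * w * (2 * x + \<i>))"

(* The integral over the real line as the limit of the integrals over {-R..R}; remove_sings
   fills in the removable singularities of f. Integrability is demanded explicitly because
   "integral" is 0 for non-integrable functions. *)
definition has_real_line_integral :: "(complex \<Rightarrow> complex) \<Rightarrow> complex \<Rightarrow> bool" where
  "has_real_line_integral f I \<longleftrightarrow>
     (\<forall>R::real. (\<lambda>x. remove_sings f (of_real x)) integrable_on {-R..R}) \<and>
     ((\<lambda>R::real. integral {-R..R} (\<lambda>x. remove_sings f (of_real x))) \<longlongrightarrow> I) at_top"

end

theory Submission imports Defs begin

text \<open>
  Write \<open>F(x) = G(a x) G(a (x + \<i>))\<close> and \<open>S(x) = sinh (\<pi> w (2 x + \<i>))\<close>, so that the integrand is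
  \<open>f = F / S\<close>. The reflection \<open>x \<mapsto> - \<i> - x\<close> exchanges the two edges of the strip and reverses their
  direction. It preserves \<open>F\<close>, because the signs of the two factors \<open>G\<close> cancel whether \<open>G\<close> is
  odd or even, and it negates \<open>S\<close>. Hence the two edges of the strip contribute equally to the
  integral of \<open>f\<close> around a long rectangle, the vertical sides contribute nothing in the limit, and
  the residue theorem gives \<open>- \<pi> \<i>\<close> times the sum of the residues of \<open>f\<close> in the open strip
  (lemma \<open>odd_strip_integral\<close>).

  The zeros of \<open>S\<close> are the points \<open>x\<^sub>n = - \<i>/2 + \<i> n/(2 w)\<close>, \<open>n \<in> \<int>\<close>. They are simple, and
  the residue of \<open>f\<close> at \<open>x\<^sub>n\<close> is \<open>(-1)\<^sup>n F(x\<^sub>n) / (2 \<pi> w)\<close>, even if \<open>F\<close> vanishes there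
  (lemma \<open>residue_sinh_quotient\<close>). Since \<open>Im x\<^sub>n = - 1/2 + n q / (2 (q\<^sup>2 + r\<^sup>2))\<close>, the closed strip contains
  exactly the \<open>x\<^sub>n\<close> with \<open>\<bar>n\<bar> \<le> M\<close>. If \<open>(q\<^sup>2 + r\<^sup>2) / \<bar>q\<bar>\<close> is an integer, then \<open>x\<^sub>M\<close> and \<open>x\<^sub>-\<^sub>M\<close> lie
  on the two edges; as \<open>f\<close> has no real pole, and by reflection none on the lower edge, these
  singularities are removable and their residues are zero. So the sum over \<open>\<bar>n\<bar> \<le> M\<close> is correct in
  both cases. The reflection maps \<open>x\<^sub>n\<close> to \<open>x\<^sub>-\<^sub>n\<close>, so its terms for \<open>n\<close> and \<open>-n\<close> agree, which gives
  the formula.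
\<close>

section \<open>Integrals of functions that are odd about the centre of the strip\<close>

text \<open>
  The residue theorem is applied to the rectangles with vertices \<open>\<plusminus>R\<close> and \<open>\<plusminus>R - \<i>\<close>, inside the
  component of \<open>V\<close> that contains the strip, since \<open>V\<close> itself may be disconnected. Oddness makes the two
  horizontal sides contribute the same amount, whence \<open>- \<pi> \<i>\<close> in place of \<open>2 \<pi> \<i>\<close>.
\<close>

lemma odd_strip_integral:
  fixes f :: "complex \<Rightarrow> complex"
  assumes V: "open V" "strip \<subseteq> V" and P: "finite P" "P \<subseteq> {z. -1 < Im z \<and> Im z < 0}"
    and holo: "f holomorphic_on V - P"
    and odd: "\<And>x::real. f (- \<i> - of_real x) = - f (of_real x)"
    and lim: "(f \<longlongrightarrow> 0) strip_ends"
  shows "(\<lambda>x. f (of_real x)) integrable_on {-R..R}"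
    and "((\<lambda>R. integral {-R..R} (\<lambda>x. f (of_real x))) \<longlongrightarrow> - of_real pi * \<i> * (\<Sum>p\<in>P. residue f p)) at_top"
proof -
  have realV: "of_real x \<in> V - P" for x
    using V(2) P(2) by (auto simp: strip_def)
  have cont: "continuous_on (V - P) f"
    using holo by (rule holomorphic_on_imp_continuous_on)
  have intg: "(\<lambda>x. f (of_real x)) integrable_on {-R..R}" for R
    by (intro integrable_continuous_interval continuous_intros continuous_on_compose2[OF cont])
       (use realV in auto)
  show "(\<lambda>x. f (of_real x)) integrable_on {-R..R}" by (rule intg)
  define S where "S = connected_component_set V 0"
  have "connected strip"
    unfolding strip_def Collect_conj_eq
    by (intro convex_connected convex_Int convex_halfspace_Im_ge convex_halfspace_Im_le)
  hence "strip \<subseteq> S"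
    unfolding S_def by (intro connected_component_maximal V) (auto simp: strip_def)
  have S: "open S" "connected S" "S \<subseteq> V"
    using V by (auto simp: S_def open_connected_component connected_component_subset)
  define s where "s = 2 * of_real pi * \<i> * (\<Sum>p\<in>P. residue f p)"
  \<comment> \<open>The two vertical sides, oriented as parts of the counterclockwise boundary.\<close>
  define E where "E = (\<lambda>R. contour_integral (linepath (of_real R - \<i>) (of_real R)) f
                          + contour_integral (linepath (- of_real R) (- \<i> - of_real R)) f)"
  obtain B where B: "\<And>p. p \<in> P \<Longrightarrow> norm p \<le> B"
    using finite_imp_bounded[OF P(1)] by (auto simp: bounded_iff)
  have cint: "f contour_integrable_on linepath a b" if "closed_segment a b \<subseteq> V - P" for a b
    using continuous_on_subset[OF cont that] by (rule contour_integrable_continuous_linepath)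
  have box_strip: "cbox (- \<i> - of_real R) (of_real R) \<subseteq> strip" for R
    by (auto simp: in_cbox_complex_iff strip_def)
  have eq: "integral {-R..R} (\<lambda>x. f (of_real x)) = (E R - s) / 2"
    if R: "R > 0" "R > B" for R
  proof -
    let ?a = "- \<i> - of_real R" and ?b = "of_real R :: complex"
    have c: "Complex (Re ?b) (Im ?a) = of_real R - \<i>" "Complex (Re ?a) (Im ?b) = - of_real R"
      by (auto simp: complex_eq_iff)
    let ?g = "rectpath ?a ?b"
    have P_box: "p \<in> box ?a ?b" if "p \<in> P" for p
      using P(2) B[OF that] that R abs_Re_le_cmod[of p] by (auto simp: in_box_complex_iff)
    have path_image: "path_image ?g \<subseteq> S - P"
      using R path_image_rectpath_subset_cbox[of ?a ?b] box_strip[of R] \<open>strip \<subseteq> S\<close>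
        path_image_rectpath_inter_box[of ?a ?b] P_box by fastforce
    have "contour_integral ?g f = 2 * pi * \<i> * (\<Sum>p\<in>P. winding_number ?g p * residue f p)"
    proof (rule Residue_theorem[OF S(1,2) P(1) _ _ _ path_image])
      show "f holomorphic_on S - P"
        using S(3) by (intro holomorphic_on_subset[OF holo]) auto
      show "\<forall>z. z \<notin> S \<longrightarrow> winding_number ?g z = 0"
        using R box_strip[of R] \<open>strip \<subseteq> S\<close>
        by (intro allI impI winding_number_rectpath_outside) auto
    qed auto
    also have "(\<Sum>p\<in>P. winding_number ?g p * residue f p) = (\<Sum>p\<in>P. residue f p)"
      using P_box by (intro sum.cong) (auto simp: winding_number_rectpath)
    finally have res: "contour_integral ?g f = s" by (simp add: s_def)
    have pi: "path_image ?g = closed_segment ?a (of_real R - \<i>) \<union> closed_segment (of_real R - \<i>) ?b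
       \<union> closed_segment ?b (- of_real R) \<union> closed_segment (- of_real R) ?a"
      unfolding rectpath_def Let_def c by (simp add: path_image_join Un_assoc)
    have sides: "f contour_integrable_on linepath ?a (of_real R - \<i>)"
       "f contour_integrable_on linepath (of_real R - \<i>) ?b"
       "f contour_integrable_on linepath ?b (- of_real R)"
       "f contour_integrable_on linepath (- of_real R) ?a"
      using path_image S(3) unfolding pi by (auto intro!: cint)
    have "s = contour_integral (linepath ?a (of_real R - \<i>)) f + (contour_integral (linepath (of_real R - \<i>) ?b) f
       + (contour_integral (linepath ?b (- of_real R)) f + contour_integral (linepath (- of_real R) ?a) f))"
      unfolding res[symmetric] rectpath_def Let_def c
      using sides by (simp add: contour_integrable_joinI valid_path_join)
    also have "contour_integral (linepath ?a (of_real R - \<i>)) f = contour_integral (linepath ?b (- of_real R)) f"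
    proof -
      \<comment> \<open>The reflection maps the point with parameter \<open>t\<close> on one side to that on the other.\<close>
      have h: "f (linepath ?a (of_real R - \<i>) t) * (of_real R - \<i> - ?a)
             = f (linepath ?b (- of_real R) t) * (- of_real R - ?b)" for t
      proof -
        have "linepath ?a (of_real R - \<i>) t = - \<i> - of_real (R - 2 * R * t)"
             "linepath ?b (- of_real R) t = of_real (R - 2 * R * t)"
          by (auto simp: linepath_def algebra_simps scaleR_conv_of_real)
        thus ?thesis using odd[of "R - 2 * R * t"] by simp
      qed
      show ?thesis
        unfolding contour_integral_integral vector_derivative_linepath_at h by (rule refl)
    qed
    also have "contour_integral (linepath ?b (- of_real R)) f
        = - integral {-R..R} (\<lambda>x. f (of_real x))"
    proof -
      have "contour_integral (linepath ?b (- of_real R)) f = - contour_integral (linepath (- of_real R) ?b) f"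
        using contour_integral_reversepath[of "linepath (- of_real R) ?b" f] by simp
      also have "contour_integral (linepath (- of_real R) ?b) f = integral {-R..R} (\<lambda>x. f (of_real x))"
        using R by (subst contour_integral_linepath_Reals_eq) auto
      finally show ?thesis .
    qed
    finally show ?thesis
      by (simp add: E_def field_simps)
  qed
  have "(E \<longlongrightarrow> 0) at_top"
  proof (rule tendstoI)
    fix e :: real assume "e > 0"
    hence "eventually (\<lambda>z. dist (f z) 0 < e/4) strip_ends"
      by (intro tendstoD[OF lim]) auto
    then obtain X where X: "\<And>z. z \<in> strip \<Longrightarrow> X \<le> \<bar>Re z\<bar> \<Longrightarrow> norm (f z) < e/4"
      unfolding eventually_strip_ends by auto
    have small: "dist (E R) 0 < e" if R: "R > X" "R > 0" "R > B" for R
    proof -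
      have bd: "norm (contour_integral (linepath a b) f) \<le> e/4"
        if ab: "closed_segment a b \<subseteq> {z. \<bar>Re z\<bar> = R \<and> -1 \<le> Im z \<and> Im z \<le> 0}" "norm (b - a) = 1" for a b
      proof -
        have "z \<notin> P" if "\<bar>Re z\<bar> = R" for z
          using B[of z] abs_Re_le_cmod[of z] that R by auto
        hence "closed_segment a b \<subseteq> V - P"
          using ab(1) V(2) by (auto simp: strip_def)
        hence "(f has_contour_integral contour_integral (linepath a b) f) (linepath a b)"
          using cint has_contour_integral_integral by blast
        hence "norm (contour_integral (linepath a b) f) \<le> e/4 * norm (b - a)"
          by (rule has_contour_integral_bound_linepath)
             (use X R ab(1) \<open>e > 0\<close> in \<open>fastforce simp: strip_def intro: less_imp_le\<close>)+
        thus ?thesis using ab(2) by simp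
      qed
      have "norm (E R) \<le> e/4 + e/4"
        unfolding E_def
        by (intro norm_triangle_mono bd)
           (use R in \<open>auto simp: closed_segment_same_Re closed_segment_eq_real_ivl norm_minus_commute\<close>)
      thus ?thesis using \<open>e > 0\<close> by simp
    qed
    show "eventually (\<lambda>R. dist (E R) 0 < e) at_top"
      using eventually_gt_at_top[of X] eventually_gt_at_top[of 0] eventually_gt_at_top[of B]
      by eventually_elim (rule small)
  qed
  hence "((\<lambda>R. (E R - s) / 2) \<longlongrightarrow> (0 - s) / 2) at_top"
    by (intro tendsto_intros) auto
  moreover have "eventually (\<lambda>R. (E R - s) / 2 = integral {-R..R} (\<lambda>x. f (of_real x))) at_top"
    using eventually_gt_at_top[of 0] eventually_gt_at_top[of B]
    by eventually_elim (simp add: eq)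
  ultimately have "((\<lambda>R. integral {-R..R} (\<lambda>x. f (of_real x))) \<longlongrightarrow> (0 - s) / 2) at_top"
    by (rule Lim_transform_eventually)
  thus "((\<lambda>R. integral {-R..R} (\<lambda>x. f (of_real x))) \<longlongrightarrow> - of_real pi * \<i> * (\<Sum>p\<in>P. residue f p)) at_top"
    by (simp add: s_def mult.assoc)
qed

section \<open>Residues at the zeros of the hyperbolic sine\<close>

lemma tendsto_quotient_common_zero:
  assumes "F analytic_on {p}" "F p = 0" "S p = 0"
    and "(S has_field_derivative d) (at p)" "d \<noteq> 0"
  shows "\<exists>c. (\<lambda>z. F z / S z) \<midarrow>p\<rightarrow> c"
proof -
  have "(F has_field_derivative deriv F p) (at p)"
    using assms(1) analytic_on_imp_differentiable_at DERIV_deriv_iff_field_differentiable by blast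
  from lhopital_complex_simple[OF this assms(4) assms(2,3,5) refl] show ?thesis by blast
qed

text \<open>
  This extends \<open>residue_simple_pole_deriv\<close> to numerators that vanish at \<open>p\<close>, where the
  quotient has a removable singularity and not a pole.
\<close>
lemma residue_simple_zero_quotient:
  assumes F: "F analytic_on {p}" and S: "S analytic_on {p}" "S p = 0"
    and d: "(S has_field_derivative d) (at p)" "d \<noteq> 0"
  shows "residue (\<lambda>z. F z / S z) p = F p / d"
proof (cases "F p = 0")
  case True
  let ?f = "\<lambda>z. F z / S z"
  have iso: "isolated_singularity_at ?f p"
    using analytic_on_imp_meromorphic_on[OF F] analytic_on_imp_meromorphic_on[OF S(1)]
    by (intro meromorphic_on_isolated_singularity meromorphic_intros)
  obtain c where "?f \<midarrow>p\<rightarrow> c"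
    using tendsto_quotient_common_zero[OF F True S(2) d] by blast
  hence "remove_sings ?f analytic_on {p}"
    by (rule remove_sings_analytic_at[OF iso])
  then obtain A where "open A" "p \<in> A" "remove_sings ?f holomorphic_on A"
    by (auto simp: analytic_at)
  hence "residue (remove_sings ?f) p = 0" using residue_holo by blast
  thus ?thesis using True iso by simp
next
  case False
  obtain A where "open A" "p \<in> A" "F holomorphic_on A" "S holomorphic_on A"
    using F S(1) by (metis analytic_at_two)
  then obtain e where "e > 0" "ball p e \<subseteq> A" using open_contains_ball by blast
  show ?thesis
    by (rule residue_simple_pole_deriv[where s = "ball p e"])
       (use \<open>ball p e \<subseteq> A\<close> \<open>e > 0\<close> \<open>F holomorphic_on A\<close> \<open>S holomorphic_on A\<close> False S d
        in \<open>auto intro: holomorphic_on_subset\<close>)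
qed

lemma complex_sinh_eq_0_iff:
  fixes z :: complex
  shows "sinh z = 0 \<longleftrightarrow> (\<exists>n::int. z = \<i> * of_int n * of_real pi)"
proof -
  have "sinh z = 0 \<longleftrightarrow> exp z = exp (-z)"
    by (simp add: sinh_field_def)
  also have "\<dots> \<longleftrightarrow> (\<exists>n::int. z = - z + (of_int (2 * n) * pi) * \<i>)"
    by (rule exp_eq)
  also have "\<dots> \<longleftrightarrow> (\<exists>n::int. z = \<i> * of_int n * of_real pi)"
    by (intro ex_cong1) (auto simp: complex_eq_iff)
  finally show ?thesis .
qed

lemma complex_cosh_int_pi:
  "cosh (\<i> * of_int n * of_real pi :: complex) = (if even n then 1 else -1)"
proof -
  have "exp (\<i> * of_int n * of_real pi :: complex) = cis (pi * of_int n)"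
       "exp (- (\<i> * of_int n * of_real pi) :: complex) = cis (- (pi * of_int n))"
    by (simp_all add: cis_conv_exp mult_ac)
  thus ?thesis
    by (simp add: cosh_field_def complex_eq_iff cos_npi_int)
qed

text \<open>For \<open>w \<noteq> 0\<close>, this is the solution \<open>x\<close> of \<open>\<pi> w (2 x + \<i>) = \<pi> \<i> n\<close>.\<close>
definition sinh_pole :: "complex \<Rightarrow> int \<Rightarrow> complex" where
  "sinh_pole w n = - \<i> / 2 + \<i> * of_int n / (2 * w)"

lemma sinh_eq_0_iff_sinh_pole:
  assumes "w \<noteq> 0"
  shows "sinh (of_real pi * w * (2 * x + \<i>)) = 0 \<longleftrightarrow> (\<exists>n. x = sinh_pole w n)"
proof -
  have "of_real pi * w * (2 * x + \<i>) = \<i> * of_int n * of_real pi \<longleftrightarrow> x = sinh_pole w n" for n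
  proof -
    have "of_real pi * w * (2 * x + \<i>) = \<i> * of_int n * of_real pi
            \<longleftrightarrow> of_real pi * (w * (2 * x + \<i>)) = of_real pi * (\<i> * of_int n)"
      by (simp only: ac_simps)
    also have "\<dots> \<longleftrightarrow> w * (2 * x + \<i>) = \<i> * of_int n"
      by (subst mult_cancel_left) simp
    also have "\<dots> \<longleftrightarrow> x = sinh_pole w n"
      using assms by (auto simp: sinh_pole_def field_simps)
    finally show ?thesis .
  qed
  thus ?thesis unfolding complex_sinh_eq_0_iff by simp
qed

lemma sinh_pole_minus: "sinh_pole w (- n) = - \<i> - sinh_pole w n"
  by (simp add: sinh_pole_def field_simps)

lemma Im_sinh_pole: "Im (sinh_pole w n) = - 1 / 2 + of_int n * (Re w / ((Re w)\<^sup>2 + (Im w)\<^sup>2)) / 2"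
proof -
  have "sinh_pole w n = - \<i> / 2 + of_real (of_int n / 2) * (\<i> / w)"
    by (simp add: sinh_pole_def)
  moreover have "Im (- \<i> / 2 + of_real k * u) = - 1 / 2 + k * Im u" for k u
    by simp
  ultimately show ?thesis by (simp only:) (simp add: Im_divide)
qed

lemma residue_sinh_quotient:
  assumes "w \<noteq> 0" "F analytic_on {sinh_pole w n}"
  shows "residue (\<lambda>x. F x / sinh (of_real pi * w * (2 * x + \<i>))) (sinh_pole w n)
           = (if even n then 1 else -1) * F (sinh_pole w n) / (2 * of_real pi * w)"
proof -
  let ?z = "\<lambda>x. of_real pi * w * (2 * x + \<i>)"
  let ?e = "if even n then 1 else -1 :: complex"
  have z: "?z (sinh_pole w n) = \<i> * of_int n * of_real pi"
    using assms(1) by (simp add: sinh_pole_def field_simps)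
  have "residue (\<lambda>x. F x / sinh (?z x)) (sinh_pole w n) = F (sinh_pole w n) / (2 * of_real pi * w * ?e)"
  proof (rule residue_simple_zero_quotient[OF assms(2)])
    show "(\<lambda>x. sinh (?z x)) analytic_on {sinh_pole w n}"
      by (auto simp: sinh_field_def intro!: analytic_intros)
    show "sinh (?z (sinh_pole w n)) = 0"
      using assms(1) sinh_eq_0_iff_sinh_pole by blast
    have "((\<lambda>x. sinh (?z x)) has_field_derivative cosh (?z (sinh_pole w n)) * (2 * of_real pi * w)) (at (sinh_pole w n))"
      by (auto intro!: derivative_eq_intros)
    thus "((\<lambda>x. sinh (?z x)) has_field_derivative 2 * of_real pi * w * ?e) (at (sinh_pole w n))"
      unfolding z complex_cosh_int_pi by (simp only: mult.commute)
  qed (use assms in auto)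
  thus ?thesis by auto
qed

lemma tendsto_reflect:
  fixes f :: "complex \<Rightarrow> complex"
  assumes "f \<midarrow>x\<rightarrow> c" and "eventually (\<lambda>z. f (p - z) = - f z) (at x)"
  shows "f \<midarrow>p - x\<rightarrow> - c"
proof -
  have lim: "filterlim (\<lambda>y. p - y) (at x) (at (p - x))"
    unfolding filterlim_at
    by (auto simp: eventually_at_filter intro!: tendsto_eq_intros always_eventually)
  have "((\<lambda>y. - f (p - y)) \<longlongrightarrow> - c) (at (p - x))"
    by (intro tendsto_minus filterlim_compose[OF assms(1) lim])
  moreover have "eventually (\<lambda>y. - f (p - y) = f y) (at (p - x))"
    using eventually_compose_filterlim[OF assms(2) lim] by eventually_elim simp
  ultimately show ?thesis by (rule Lim_transform_eventually)
qed

lemma sum_even_symmetric_interval: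
  fixes g :: "int \<Rightarrow> 'a :: comm_semiring_1"
  assumes "\<And>k. k \<in> {1..m} \<Longrightarrow> g (- int k) = g (int k)"
  shows "(\<Sum>n=-int m..int m. g n) = g 0 + 2 * (\<Sum>k=1..m. g (int k))"
  using assms
proof (induction m)
  case (Suc m)
  have "{-int (Suc m)..int (Suc m)} = insert (- int (Suc m)) (insert (int (Suc m)) {-int m..int m})"
    by auto
  thus ?case
    using Suc Suc.prems[of "Suc m"] by (simp add: algebra_simps mult_2)
qed simp

section \<open>The integral formula\<close>

theorem mainTheorem11:
  fixes a q r :: real and w :: complex and U :: "complex set" and G :: "complex \<Rightarrow> complex"
    and M :: nat
  defines "w \<equiv> of_real q + \<i> * of_real r"
    and "M \<equiv> nat \<lfloor>(q\<^sup>2 + r\<^sup>2) / \<bar>q\<bar>\<rfloor>"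
  assumes "q \<noteq> 0"
    and "open U" and "\<forall>z\<in>U. -z \<in> U"
    and "{of_real a * x |x. \<bar>Im x\<bar> \<le> 1} \<subseteq> U"
    and "G analytic_on U"
    and "(\<forall>z\<in>U. G (-z) = - G z) \<or> (\<forall>z\<in>U. G (-z) = G z)"
    and "(\<lambda>x. G (of_real a * x) * G (of_real a * (x + \<i>)))
           \<in> o[strip_ends](\<lambda>x. of_real (exp (pi * norm x) / norm x))"
    and "(integrand G a w \<longlongrightarrow> 0) strip_ends"
    and "\<forall>x::real. \<not> is_pole (integrand G a w) (of_real x)"
  shows "has_real_line_integral (integrand G a w)
           (- (\<i> / 2) * (G (- (\<i> * of_real a / 2)) * G (\<i> * of_real a / 2) / w)
            + \<i> / w * (\<Sum>n=1..M. (-1) ^ (n + 1)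
                * G (- (\<i> * (w - of_nat n) * of_real a / (2 * w)))
                * G (\<i> * (w + of_nat n) * of_real a / (2 * w))))"
proof -
  note U = assms(4-6) and G = assms(7,8) and lim = assms(10) and no_pole = assms(11)
  have w: "w \<noteq> 0" using \<open>q \<noteq> 0\<close> by (auto simp: w_def complex_eq_iff)
  define c where "c = q / (q\<^sup>2 + r\<^sup>2)"
  have c: "c \<noteq> 0" using \<open>q \<noteq> 0\<close> by (auto simp: c_def sum_power2_eq_zero_iff)
  have Im_pole: "Im (sinh_pole w n) = - 1 / 2 + of_int n * c / 2" for n
    unfolding Im_sinh_pole by (simp add: w_def c_def)
  have M: "M = nat \<lfloor>1 / \<bar>c\<bar>\<rfloor>"
    using \<open>q \<noteq> 0\<close> by (simp add: M_def c_def abs_mult)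
  have "1 / \<bar>c\<bar> < real M + 1"
    unfolding M by linarith
  hence M_gt: "(real M + 1) * \<bar>c\<bar> > 1"
    using c by (simp add: field_simps)
  have M_ge: "\<bar>n\<bar> \<le> int M" if "\<bar>of_int n * c\<bar> < (real M + 1) * \<bar>c\<bar>" for n :: int
  proof -
    have "\<bar>real_of_int n\<bar> < real M + 1" using that c by (simp add: abs_mult)
    thus ?thesis by linarith
  qed
  have M_le: "\<bar>of_int n * c\<bar> \<le> 1" if "\<bar>n\<bar> \<le> int M" for n :: int
  proof -
    have "\<bar>real_of_int n\<bar> \<le> 1 / \<bar>c\<bar>"
      using that unfolding M by (simp add: le_nat_floor le_floor_iff)
    thus ?thesis using c by (simp add: field_simps abs_mult)
  qed

  let ?f = "integrand G a w"
  define F where "F = (\<lambda>x. G (of_real a * x) * G (of_real a * (x + \<i>)))"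
  define S where "S = (\<lambda>x. sinh (of_real pi * w * (2 * x + \<i>)))"
  have f_eq: "?f = (\<lambda>x. F x / S x)"
    by (simp add: F_def S_def integrand_def fun_eq_iff)
  define A where "A = (\<lambda>x. of_real a * x) -` U \<inter> (\<lambda>x. of_real a * (x + \<i>)) -` U"
  have "open A" unfolding A_def
    by (intro open_Int open_vimage U continuous_intros)
  have strip_A: "strip \<subseteq> A" using U(3) by (fastforce simp: A_def strip_def)
  have F: "F analytic_on A"
    unfolding F_def A_def
    by (intro analytic_on_mult analytic_on_compose[OF _ analytic_on_subset[OF G(1)], unfolded o_def]
         analytic_intros) auto
  have S: "S analytic_on X" for X
    unfolding S_def sinh_field_def by (auto intro!: analytic_intros)
  have refl_eq: "of_real a * (- \<i> - x) = - (of_real a * (x + \<i>))"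
     "of_real a * (- \<i> - x + \<i>) = - (of_real a * x)" for x :: complex
    by (simp_all add: algebra_simps)
  have F_refl: "F (- \<i> - x) = F x" if "x \<in> A" for x
    using G(2) that unfolding F_def A_def refl_eq by auto
  have S_refl: "S (- \<i> - x) = - S x" for x
    unfolding S_def sinh_minus[symmetric] by (simp add: algebra_simps)
  have f_refl: "?f (- \<i> - x) = - ?f x" if "x \<in> A" for x
    using that by (simp add: f_eq F_refl S_refl)
  have S_0: "S x = 0 \<longleftrightarrow> (\<exists>n. x = sinh_pole w n)" for x
    unfolding S_def by (rule sinh_eq_0_iff_sinh_pole[OF w])
  have mero: "?f meromorphic_on {x}" if "x \<in> A" for x
    unfolding f_eq using that
    by (intro meromorphic_intros analytic_on_imp_meromorphic_on S analytic_on_subset[OF F]) auto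
  have ana: "?f analytic_on {x}" if "x \<in> A" "S x \<noteq> 0" for x
    unfolding f_eq using that
    by (intro analytic_on_divide S analytic_on_subset[OF F]) auto
  have real_A: "of_real x \<in> A" for x
    using strip_A by (auto simp: strip_def)

  \<comment> \<open>Only the real axis is assumed to be free of poles; the reflection extends this to the lower
     edge of the strip.\<close>
  have real_lim: "\<exists>l. ?f \<midarrow>of_real x\<rightarrow> l \<and> ?f \<midarrow>- \<i> - of_real x\<rightarrow> - l" for x
  proof -
    have "not_essential ?f (of_real x)"
      using mero[OF real_A] meromorphic_at_iff by blast
    then obtain l where l: "?f \<midarrow>of_real x\<rightarrow> l"
      using no_pole by (auto simp: not_essential_def)
    have "eventually (\<lambda>z. z \<in> A) (at (of_real x))"
      by (rule eventually_at_in_open'[OF \<open>open A\<close> real_A])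
    hence "eventually (\<lambda>z. ?f (- \<i> - z) = - ?f z) (at (of_real x))"
      by eventually_elim (rule f_refl)
    from tendsto_reflect[OF l this] l show ?thesis by blast
  qed

  \<comment> \<open>The bound on the imaginary part admits the strip, because \<open>(M + 1) \<bar>c\<bar> > 1\<close>, but no zero
     \<open>sinh_pole w n\<close> of \<open>S\<close> with \<open>\<bar>n\<bar> > M\<close>, so that only finitely many singularities remain.\<close>
  define V where "V = A \<inter> {x. \<bar>Im x + 1/2\<bar> < (real M + 1) * \<bar>c\<bar> / 2}"
  have "\<bar>Im x + 1/2\<bar> \<le> 1/2" if "x \<in> strip" for x
    using that unfolding strip_def mem_Collect_eq by linarith
  hence "strip \<subseteq> V"
    unfolding V_def using strip_A M_gt by fastforce
  moreover have "open V"
    unfolding V_def by (intro open_Int \<open>open A\<close> open_Collect_less continuous_intros)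
  ultimately have V: "open V" "strip \<subseteq> V" by auto
  have pole_V: "\<exists>n. \<bar>n\<bar> \<le> int M \<and> x = sinh_pole w n" if x: "x \<in> V" "S x = 0" for x
  proof -
    obtain n where n: "x = sinh_pole w n"
      using x(2) S_0[of x] by auto
    have "\<bar>of_int n * c\<bar> < (real M + 1) * \<bar>c\<bar>"
      using x(1) by (simp add: V_def n Im_pole)
    from M_ge[OF this] n show ?thesis by (intro exI[of _ n]) simp
  qed
  \<comment> \<open>The indices of the zeros of \<open>S\<close> in the open strip; \<open>N\<close> lacks \<open>\<plusminus>M\<close> if these zeros lie on
     the edges of the strip.\<close>
  define N where "N = {n \<in> {-int M..int M}. \<bar>of_int n * c\<bar> < 1}"
  have Im_N: "-1 < Im (sinh_pole w n) \<and> Im (sinh_pole w n) < 0" if "n \<in> N" for n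
    using that unfolding Im_pole by (auto simp: N_def)
  have boundary: "\<exists>x::real. sinh_pole w n = of_real x \<or> sinh_pole w n = - \<i> - of_real x"
    if "\<bar>n\<bar> \<le> int M" "n \<notin> N" for n
  proof -
    have "\<bar>of_int n * c\<bar> = 1"
      using M_le[OF that(1)] that by (auto simp: N_def)
    hence "Im (sinh_pole w n) = 0 \<or> Im (sinh_pole w n) = -1"
      unfolding Im_pole by linarith
    hence "sinh_pole w n = of_real (Re (sinh_pole w n)) \<or>
           sinh_pole w n = - \<i> - of_real (- Re (sinh_pole w n))"
      by (auto simp: complex_eq_iff)
    thus ?thesis by blast
  qed

  define P where "P = sinh_pole w ` N"
  have holo: "remove_sings ?f holomorphic_on V - P"
  proof -
    have "remove_sings ?f analytic_on {x}" if x: "x \<in> V - P" for x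
    proof (cases "S x = 0")
      case False
      thus ?thesis using x by (intro remove_sings_analytic_on ana) (auto simp: V_def)
    next
      case True
      then obtain n where n: "\<bar>n\<bar> \<le> int M" "x = sinh_pole w n"
        using pole_V[of x] x by auto
      with x have "n \<notin> N" by (auto simp: P_def)
      then obtain y :: real where "x = of_real y \<or> x = - \<i> - of_real y"
        using boundary[OF n(1)] n(2) by blast
      then obtain l where "?f \<midarrow>x\<rightarrow> l"
        using real_lim[of y] by blast
      moreover have "isolated_singularity_at ?f x"
        using mero[of x] x by (auto simp: V_def meromorphic_at_iff)
      ultimately show ?thesis by (intro remove_sings_analytic_at)
    qed
    thus ?thesis
      using analytic_on_analytic_at analytic_imp_holomorphic by blast
  qed

  have lim': "(remove_sings ?f \<longlongrightarrow> 0) strip_ends"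
  proof (rule Lim_transform_eventually[OF lim])
    define X where "X = Max ((\<lambda>n. \<bar>Re (sinh_pole w n)\<bar>) ` {-int M..int M})"
    have "S x \<noteq> 0" if "x \<in> strip" "X + 1 \<le> \<bar>Re x\<bar>" for x
    proof
      assume "S x = 0"
      then obtain n where n: "\<bar>n\<bar> \<le> int M" "x = sinh_pole w n"
        using pole_V[of x] \<open>x \<in> strip\<close> V(2) by auto
      have "n \<in> {-int M..int M}" using n(1) by auto
      hence "\<bar>Re x\<bar> \<le> X" unfolding X_def n(2) by (intro Max_ge imageI) auto
      with that show False by simp
    qed
    thus "eventually (\<lambda>x. ?f x = remove_sings ?f x) strip_ends"
      unfolding eventually_strip_ends
      using ana strip_A by (intro exI[of _ "X + 1"]) auto
  qed

  have odd: "remove_sings ?f (- \<i> - of_real x) = - remove_sings ?f (of_real x)" for x :: real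
  proof -
    obtain l where "?f \<midarrow>of_real x\<rightarrow> l" "?f \<midarrow>- \<i> - of_real x\<rightarrow> - l"
      using real_lim by blast
    thus ?thesis by (simp only: remove_sings_eqI)
  qed

  have "N \<subseteq> {-int M..int M}" unfolding N_def by blast
  hence "finite N" using finite_atLeastAtMost_int by (rule finite_subset)
  hence "finite P" unfolding P_def by (rule finite_imageI)
  have P_sub: "P \<subseteq> {z. -1 < Im z \<and> Im z < 0}" using Im_N unfolding P_def by auto

  define g where "g = (\<lambda>n. (if even n then 1 else -1) * F (sinh_pole w n))"
  have pole_A: "sinh_pole w n \<in> A" if "\<bar>n\<bar> \<le> int M" for n
    using M_le[OF that] strip_A by (auto simp: strip_def Im_pole)
  have g_even: "g (- n) = g n" if "\<bar>n\<bar> \<le> int M" for n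
    using F_refl[OF pole_A[OF that]] by (simp add: g_def sinh_pole_minus)
  have res: "residue (remove_sings ?f) (sinh_pole w n) = g n / (2 * of_real pi * w)"
    if "\<bar>n\<bar> \<le> int M" for n
  proof -
    have "isolated_singularity_at ?f (sinh_pole w n)"
      using mero[OF pole_A[OF that]] meromorphic_at_iff by blast
    hence "residue (remove_sings ?f) (sinh_pole w n) = residue ?f (sinh_pole w n)"
      by (rule residue_remove_sings)
    also have "\<dots> = g n / (2 * of_real pi * w)"
      unfolding f_eq S_def g_def using pole_A[OF that]
      by (intro residue_sinh_quotient w analytic_on_subset[OF F]) auto
    finally show ?thesis .
  qed
  have res_0: "residue (remove_sings ?f) (sinh_pole w n) = 0" if "\<bar>n\<bar> \<le> int M" "n \<notin> N" for n
  proof -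
    have "sinh_pole w n \<in> V - P"
    proof -
      obtain x :: real where "sinh_pole w n = of_real x \<or> sinh_pole w n = - \<i> - of_real x"
        using boundary \<open>\<bar>n\<bar> \<le> int M\<close> \<open>n \<notin> N\<close> by blast
      thus ?thesis using P_sub V(2) by (auto simp: strip_def)
    qed
    moreover have "open (V - P)"
      using V(1) \<open>finite P\<close> by (simp add: finite_imp_closed open_Diff)
    ultimately show ?thesis using holo residue_holo by blast
  qed
  have integral: "has_real_line_integral ?f (- of_real pi * \<i> * (\<Sum>p\<in>P. residue (remove_sings ?f) p))"
    unfolding has_real_line_integral_def
    using odd_strip_integral[OF V \<open>finite P\<close> P_sub holo odd lim'] by blast

  have "inj_on (sinh_pole w) N"
    using w by (auto simp: inj_on_def sinh_pole_def)
  hence "(\<Sum>p\<in>P. residue (remove_sings ?f) p) = (\<Sum>n\<in>N. residue (remove_sings ?f) (sinh_pole w n))"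
    unfolding P_def by (simp add: sum.reindex)
  also have "\<dots> = (\<Sum>n=-int M..int M. residue (remove_sings ?f) (sinh_pole w n))"
    by (rule sum.mono_neutral_left) (auto simp: N_def intro!: res_0)
  also have "\<dots> = (\<Sum>n=-int M..int M. g n) / (2 * of_real pi * w)"
    unfolding sum_divide_distrib by (intro sum.cong refl res) auto
  also have "(\<Sum>n=-int M..int M. g n) = g 0 + 2 * (\<Sum>k=1..M. g (int k))"
    by (intro sum_even_symmetric_interval g_even) auto
  finally have "- of_real pi * \<i> * (\<Sum>p\<in>P. residue (remove_sings ?f) p)
      = - (\<i> / 2) * (g 0 / w) + \<i> / w * (\<Sum>k=1..M. - g (int k))"
    using w by (simp add: field_simps sum_negf)
  also have "g 0 = G (- (\<i> * of_real a / 2)) * G (\<i> * of_real a / 2)"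
    by (simp add: g_def F_def sinh_pole_def mult_ac)
  also have "(\<Sum>k=1..M. - g (int k)) = (\<Sum>n=1..M. (-1) ^ (n + 1)
                * G (- (\<i> * (w - of_nat n) * of_real a / (2 * w)))
                * G (\<i> * (w + of_nat n) * of_real a / (2 * w)))"
  proof (intro sum.cong refl)
    fix n :: nat
    have "of_real a * sinh_pole w (int n) = - (\<i> * (w - of_nat n) * of_real a / (2 * w))"
      "of_real a * (sinh_pole w (int n) + \<i>) = \<i> * (w + of_nat n) * of_real a / (2 * w)"
      using w by (simp_all add: sinh_pole_def field_simps)
    thus "- g (int n) = (-1) ^ (n + 1)
                * G (- (\<i> * (w - of_nat n) * of_real a / (2 * w)))
                * G (\<i> * (w + of_nat n) * of_real a / (2 * w))"
      by (simp add: g_def F_def)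
  qed
  finally show ?thesis
    using integral by (rule subst[where P = "has_real_line_integral ?f"])
qed

end
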